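(* Let $\lambda>0$ and let $Q$ be a probability distribution on $\mathbb{N}=\{1,2,\ldots\}$. If $Q$ and the compound Poisson distribution $\mathrm{CPo}(\lambda,Q)$ are both log-concave, then $$H(\mathrm{CPo}(\lambda,Q))=\max\Big\{H(C_QP)\;:\; P \text{ an ultra-log-concave distribution on } \mathbb{Z}_+ \text{ with mean } \lambda\Big\}.$$
   Context: $\mathbb{Z}_+=\{0,1,2,\ldots\}$, $\mathbb{N}=\{1,2,\ldots\}$. For a probability mass function $P$ on $\mathbb{Z}_+$, $H(P)=-\sum_x P(x)\log P(x)$ is the discrete entropy (natural logarithm, $0\log 0=0$). A distribution $P$ on $\mathbb{Z}_+$ is log-concave if its support is a (possibly infinite) interval of successive integers and $P(x)^2\ge P(x+1)P(x-1)$ for all $x\ge1$. A distribution $Q$ on $\mathbb{N}$ is regarded as a distribution on $\mathbb{Z}_+$ with $Q(0)=0$. A distribution $P$ on $\mathbb{Z}_+$ is ultra-log-concave if $P(x)/\Pi_\lambda(x)$ is a log-concave sequence for some (equivalently all) $\lambda>0$, where $\Pi_\lambda(x)=e^{-\lambda}\lambda^x/x!$; that is, its support is an interval of successive integers and $xP(x)^2\ge (x+1)P(x+1)P(x-1)$ for all $x\ge1$. For $P$ on $\mathbb{Z}_+$ and $Q$ on $\mathbb{N}$, the $Q$-compound distribution $C_QP$ is the law of $\sum_{j=1}^Y X_j$, where $Y\sim P$ and the $X_j$ are i.i.d. with law $Q$, independent of $Y$ (the empty sum is $0$); equivalently $C_QP(x)=\sum_{y\ge0}P(y)Q^{*y}(x)$,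 with $Q^{*y}$ the $y$-fold convolution power and $Q^{*0}$ the point mass at $0$. The compound Poisson distribution is $\mathrm{CPo}(\lambda,Q)=C_Q\Pi_\lambda$. *)

theory Defs
  imports "HOL-Probability.Probability"
begin

text \<open>
  Probability distributions on \<open>{0, 1, 2, \<dots>}\<close> are elements of \<open>nat pmf\<close>. A distribution \<open>Q\<close> on
  \<open>{1, 2, \<dots>}\<close> is a \<open>nat pmf\<close> with \<open>pmf Q 0 = 0\<close>.
\<close>

text \<open>
  The terms \<open>- p * ln p\<close> are nonnegative for \<open>0 \<le> p \<le> 1\<close> (and vanish at \<open>p = 0\<close>), so taking the
  sum in \<open>ennreal\<close> loses nothing and gives infinite entropies their true value.
\<close>

definition discrete_entropy :: "nat pmf \<Rightarrow> ennreal" where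
  "discrete_entropy P = (\<Sum>x. ennreal (- (pmf P x * ln (pmf P x))))"

text \<open>Meant for nonnegative sequences. The first conjunct says that the support is an interval.\<close>

definition log_concave_seq :: "(nat \<Rightarrow> real) \<Rightarrow> bool" where
  "log_concave_seq f \<longleftrightarrow>
     (\<forall>x y z. x \<le> y \<and> y \<le> z \<and> f x \<noteq> 0 \<and> f z \<noteq> 0 \<longrightarrow> f y \<noteq> 0) \<and>
     (\<forall>x\<ge>1. (f x)\<^sup>2 \<ge> f (x + 1) * f (x - 1))"

definition log_concave_pmf :: "nat pmf \<Rightarrow> bool" where
  "log_concave_pmf P \<longleftrightarrow> log_concave_seq (pmf P)"

definition ultra_log_concave_pmf :: "nat pmf \<Rightarrow> bool" where
  "ultra_log_concave_pmf P \<longleftrightarrow>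
     (\<exists>l>0. log_concave_seq (\<lambda>x. pmf P x / pmf (poisson_pmf l) x))"

definition compound_pmf :: "nat pmf \<Rightarrow> nat pmf \<Rightarrow> nat pmf" where
  "compound_pmf Q P = bind_pmf P (\<lambda>y. map_pmf sum_list (replicate_pmf y Q))"

definition compound_poisson_pmf :: "real \<Rightarrow> nat pmf \<Rightarrow> nat pmf" where
  "compound_poisson_pmf l Q = compound_pmf Q (poisson_pmf l)"

text \<open>\<open>Max\<close> is only meaningful for finite sets; this is \<open>m = max S\<close> with the maximum attained.\<close>

definition is_maximum :: "'a::order \<Rightarrow> 'a set \<Rightarrow> bool" where
  "is_maximum m S \<longleftrightarrow> m \<in> S \<and> (\<forall>h\<in>S. h \<le> m)"

text \<open>The choice of \<open>l\<close> in the definition of ultra-log-concavity is irrelevant.\<close>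

lemma log_concave_seq_div_poisson_iff:
  assumes l: "l > 0"
  shows "log_concave_seq (\<lambda>x. pmf P x / pmf (poisson_pmf l) x) \<longleftrightarrow>
     (\<forall>x y z. x \<le> y \<and> y \<le> z \<and> x \<in> set_pmf P \<and> z \<in> set_pmf P \<longrightarrow> y \<in> set_pmf P) \<and>
     (\<forall>x\<ge>1. real x * (pmf P x)\<^sup>2 \<ge> real (x + 1) * pmf P (x + 1) * pmf P (x - 1))"
proof -
  have pos: "pmf (poisson_pmf l) x > 0" for x
    using l by simp
  have ineq: "(pmf P x / pmf (poisson_pmf l) x)\<^sup>2
        \<ge> pmf P (x + 1) / pmf (poisson_pmf l) (x + 1) * (pmf P (x - 1) / pmf (poisson_pmf l) (x - 1))
      \<longleftrightarrow> real x * (pmf P x)\<^sup>2 \<ge> real (x + 1) * pmf P (x + 1) * pmf P (x - 1)"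
    if x1: "x \<ge> 1" for x
  proof -
    obtain k where k: "x = Suc k"
      using x1 by (cases x) auto
    define w where "w = pmf (poisson_pmf l) x"
    have w: "w > 0"
      using pos w_def by blast
    have 1: "pmf (poisson_pmf l) (x + 1) = w * l / real (x + 1)"
      using l by (simp add: w_def field_simps del: of_nat_Suc)
    have 2: "pmf (poisson_pmf l) (x - 1) = w * real x / l"
      using l by (simp add: w_def k field_simps del: of_nat_Suc)
    define a b c where "a = pmf P (x + 1)" and "b = pmf P (x - 1)" and "c = pmf P x"
    define u v where "u = real (x + 1)" and "v = real x"
    have uv: "u > 0" "v > 0"
      using x1 by (auto simp: u_def v_def)
    have "a / (w * l / u) * (b / (w * v / l)) = (u * a * b) / (v * w\<^sup>2)"
      using l w uv by (simp add: power2_eq_square field_simps)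
    moreover have "(c / w)\<^sup>2 = (v * c\<^sup>2) / (v * w\<^sup>2)"
      using uv by (simp add: power_divide)
    moreover have "v * w\<^sup>2 > 0"
      using uv w by simp
    ultimately have "(c / w)\<^sup>2 \<ge> a / (w * l / u) * (b / (w * v / l)) \<longleftrightarrow> v * c\<^sup>2 \<ge> u * a * b"
      by (simp only: divide_le_cancel) auto
    then show ?thesis
      unfolding 1 2 w_def[symmetric] a_def b_def c_def u_def v_def .
  qed
  have supp: "pmf P x / pmf (poisson_pmf l) x \<noteq> 0 \<longleftrightarrow> x \<in> set_pmf P" for x
    using pos[of x] by (metis divide_eq_0_iff less_irrefl set_pmf_iff)
  show ?thesis
    unfolding log_concave_seq_def supp by (intro conj_cong refl all_cong1 imp_cong ineq)
qed

end

theory Submission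
  imports Defs
begin

text \<open>
  Write \<open>F\<close> for the compound Poisson law, \<open>g = - ln F\<close> for its information function, and \<open>S y\<close> for
  a sum of \<open>y\<close> independent variables with law \<open>Q\<close>. Gibbs' inequality bounds the entropy of any
  law by its cross-entropy against \<open>F\<close>, so the entropy of the \<open>Q\<close>-compound of \<open>P\<close> is at most
  \<open>\<Sum>y. P y * G y\<close> with \<open>G y = E (g (S y))\<close>. For \<open>P\<close> the Poisson law this bound is an
  equality. What remains is the linear comparison
  \<open>\<Sum>y. P y * G y \<le> \<Sum>y. \<Pi> y * G y\<close>, where \<open>\<Pi>\<close> is the Poisson law with the same mean as \<open>P\<close>.

  Two convexity facts give it. First, \<open>G\<close> is a convex sequence: log-concavity of \<open>F\<close> makes \<open>g\<close>
  convex, and if \<open>a\<close>, \<open>b\<close> are two further summands, then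
  \<open>g (s + a) + g (s + b) \<le> g s + g (s + a + b)\<close> because both are nonnegative
  (\<open>compound_mean_convex\<close>). Second, an ultra-log-concave law lies below the Poisson law of the
  same mean in the convex order (\<open>log_concave_ratio_imp_convex_order\<close>): as \<open>P / \<Pi>\<close> is
  log-concave, \<open>P\<close> dominates \<open>\<Pi>\<close> exactly on an interval, and subtracting from a convex function
  its chord over that interval leaves a function whose sign is opposite to that of \<open>P - \<Pi>\<close>,
  while the chord itself has the same expectation under both laws.

  The information function is nonnegative, so expectations of it are taken in the extended
  nonnegative reals; where such an expectation under the Poisson law is infinite, the comparison
  is trivial. The information function itself is finite everywhere because \<open>F\<close> has full support
  (\<open>compound_poisson_pmf_pos\<close>).
\<close>

section \<open>Convex sequences\<close>

definition convex_seq :: "(nat \<Rightarrow> real) \<Rightarrow> bool" where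
  "convex_seq g \<longleftrightarrow> (\<forall>n. 2 * g (Suc n) \<le> g n + g (Suc (Suc n)))"

text \<open>
  The increments up to \<open>j\<close> are at most the increment at \<open>j\<close>, and those after it are at least that.
  Convexity is required only between \<open>i\<close> and \<open>k\<close>, so that the lemma applies to the logarithm of
  a sequence that vanishes elsewhere.
\<close>

lemma convex_three_point:
  fixes g :: "nat \<Rightarrow> real"
  assumes conv: "\<And>n. i \<le> n \<Longrightarrow> Suc (Suc n) \<le> k \<Longrightarrow> 2 * g (Suc n) \<le> g n + g (Suc (Suc n))"
    and ij: "i \<le> j" and jk: "j \<le> k"
  shows "(real k - real i) * g j \<le> (real k - real j) * g i + (real j - real i) * g k"
proof (cases "j = k")
  case False
  define d where "d n = g (Suc n) - g n" for n
  have mono: "d m \<le> d n" if "i \<le> m" "m \<le> n" "n < k" for m n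
    using that(2,1,3)
  proof (induction n rule: dec_induct)
    case (step n)
    then show ?case using conv[of n] by (simp add: d_def)
  qed simp
  have left: "g n - g i \<le> (real n - real i) * d j" if "i \<le> n" "n \<le> j" for n
    using that
  proof (induction n rule: dec_induct)
    case (step n)
    then show ?case using mono[of n j] False jk by (simp add: d_def algebra_simps)
  qed simp
  have right: "g n - g j \<ge> (real n - real j) * d j" if "j \<le> n" "n \<le> k" for n
    using that
  proof (induction n rule: dec_induct)
    case (step n)
    then show ?case using mono[of j n] ij by (simp add: d_def algebra_simps)
  qed simp
  have "(real k - real j) * (g j - g i) \<le> (real k - real j) * ((real j - real i) * d j)"
    using left[OF ij] jk by (intro mult_left_mono) auto
  also have "\<dots> = (real j - real i) * ((real k - real j) * d j)"
    by simp
  also have "\<dots> \<le> (real j - real i) * (g k - g j)"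
    using right[OF jk] ij by (intro mult_left_mono) auto
  finally show ?thesis
    by (simp add: algebra_simps)
qed simp

lemma convex_seq_three_point:
  assumes "convex_seq g" "i \<le> j" "j \<le> k"
  shows "(real k - real i) * g j \<le> (real k - real j) * g i + (real j - real i) * g k"
  using assms by (intro convex_three_point) (auto simp: convex_seq_def)

text \<open>
  The increment of \<open>g\<close> over a step of length \<open>a\<close> grows when the step is moved right by \<open>b\<close>. This
  form of convexity survives averaging over random shifts \<open>a\<close> and \<open>b\<close>.
\<close>

lemma convex_seq_shift_pair:
  assumes "convex_seq g"
  shows "g (s + a) + g (s + b) \<le> g s + g (s + a + b)"
proof -
  have diff_mono: "g (Suc n) - g n \<le> g (Suc (n + b)) - g (n + b)" for n b
  proof (induction b)
    case (Suc b)
    then show ?case using assms[unfolded convex_seq_def, rule_format, of "n + b"] by simp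
  qed simp
  show ?thesis
  proof (induction a)
    case (Suc a)
    then show ?case using diff_mono[of "s + a" b] by (simp add: add.assoc)
  qed simp
qed

lemma convex_seq_chord:
  fixes g :: "nat \<Rightarrow> real"
  assumes g: "convex_seq g" and "a < c"
  obtains u v where "\<And>y. a \<le> y \<Longrightarrow> y \<le> c \<Longrightarrow> g y \<le> u + v * real y"
    and "\<And>y. y \<le> a \<or> c \<le> y \<Longrightarrow> u + v * real y \<le> g y"
proof
  let ?D = "real c - real a"
  have D: "?D > 0" using \<open>a < c\<close> by simp
  let ?v = "(g c - g a) / ?D" and ?u = "(real c * g a - real a * g c) / ?D"
  have L: "?u + ?v * real y = ((real c - real y) * g a + (real y - real a) * g c) / ?D" for y
    by (simp add: add_divide_distrib[symmetric] algebra_simps)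
  show "g y \<le> ?u + ?v * real y" if "a \<le> y" "y \<le> c" for y
    unfolding L using convex_seq_three_point[OF g that] D
    by (simp add: pos_le_divide_eq mult.commute)
  show "?u + ?v * real y \<le> g y" if "y \<le> a \<or> c \<le> y" for y
    unfolding L using that D convex_seq_three_point[OF g, of y a c]
      convex_seq_three_point[OF g, of a c y] \<open>a < c\<close>
    by (auto simp: pos_divide_le_eq algebra_simps)
qed

section \<open>Log-concave sequences\<close>

lemma log_concave_seq_imp_neg_ln_convex:
  fixes f :: "nat \<Rightarrow> real"
  assumes f: "log_concave_seq f"
    and pos: "f n > 0" "f (Suc n) > 0" "f (Suc (Suc n)) > 0"
  shows "2 * (- ln (f (Suc n))) \<le> - ln (f n) + - ln (f (Suc (Suc n)))"
proof -
  have "f (Suc (Suc n)) * f n \<le> (f (Suc n))\<^sup>2"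
    using f[unfolded log_concave_seq_def, THEN conjunct2, rule_format, of "Suc n"] by simp
  then have "ln (f (Suc (Suc n)) * f n) \<le> ln ((f (Suc n))\<^sup>2)"
    using pos by (subst ln_le_cancel_iff) auto
  then show ?thesis
    using pos by (simp add: ln_mult ln_realpow)
qed

text \<open>
  The sequence is positive between \<open>i\<close> and \<open>k\<close> because its support is an interval, so there its
  logarithm is concave and lies above the smaller of its two nonnegative end values.
\<close>

lemma log_concave_seq_ge_one_interval:
  fixes f :: "nat \<Rightarrow> real"
  assumes f: "log_concave_seq f" and nonneg: "\<And>n. 0 \<le> f n"
    and ij: "i \<le> j" and jk: "j \<le> k" and fi: "1 \<le> f i" and fk: "1 \<le> f k"
  shows "1 \<le> f j"
proof (cases "i = k")
  case False
  have pos: "f n > 0" if "i \<le> n" "n \<le> k" for n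
    using f[unfolded log_concave_seq_def] that fi fk nonneg[of n]
    by (metis less_eq_real_def not_one_le_zero)
  have "(real k - real i) * (- ln (f j))
      \<le> (real k - real j) * (- ln (f i)) + (real j - real i) * (- ln (f k))"
    by (rule convex_three_point[OF _ ij jk], rule log_concave_seq_imp_neg_ln_convex[OF f])
       (auto intro!: pos)
  also have "\<dots> \<le> 0"
    using fi fk ij jk by (intro add_nonpos_nonpos mult_nonneg_nonpos) auto
  finally have "(real k - real i) * ln (f j) \<ge> 0" by simp
  moreover have "real k - real i > 0" using False ij jk by simp
  ultimately have "ln (f j) \<ge> 0" by (simp add: zero_le_mult_iff)
  then show ?thesis using pos[OF ij jk] by simp
qed (use assms in auto)

section \<open>Log-concave density ratios and the convex order\<close>

lemma sums_pmf: "pmf P sums 1" for P :: "nat pmf"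
proof -
  have "integrable (count_space UNIV) (pmf P)" by (rule integrable_pmf)
  from sums_integral_count_space_nat[OF this] show ?thesis
    by (simp add: integral_pmf)
qed

lemma sums_pmf_mean:
  fixes P :: "nat pmf"
  assumes "integrable (measure_pmf P) real"
  shows "(\<lambda>y. pmf P y * real y) sums measure_pmf.expectation P real"
proof -
  have "integrable (count_space UNIV) (\<lambda>y. pmf P y * real y)"
    using assms unfolding measure_pmf_eq_density
    by (subst (asm) integrable_density) auto
  from sums_integral_count_space_nat[OF this] show ?thesis
    by (simp add: measure_pmf_eq_density integral_density)
qed

lemma sums_zero_nonneg_imp_zero:
  fixes t :: "nat \<Rightarrow> real"
  assumes "t sums 0" "\<And>n. 0 \<le> t n"
  shows "t n = 0"
  using assms suminf_eq_zero_iff[of t] sums_iff by metis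

text \<open>
  By log-concavity of the ratio, the set \<open>I\<close> where \<open>P\<close> dominates \<open>R\<close> is an interval. If it is
  bounded, the chord of \<open>g\<close> over it gives the comparison. If it is unbounded, mass moves only
  upwards from \<open>R\<close> to \<open>P\<close>, which with equal means forces \<open>P = R\<close>.
\<close>

lemma log_concave_ratio_imp_convex_order:
  fixes P R :: "nat pmf" and g :: "nat \<Rightarrow> real"
  assumes ratio: "log_concave_seq (\<lambda>y. pmf P y / pmf R y)"
    and Rpos: "\<And>y. pmf R y > 0"
    and intP: "integrable (measure_pmf P) real" and intR: "integrable (measure_pmf R) real"
    and mean: "measure_pmf.expectation P real = measure_pmf.expectation R real"
    and g: "convex_seq g" and g0: "\<And>y. 0 \<le> g y"
  shows "(\<integral>\<^sup>+y. ennreal (g y) \<partial>measure_pmf P) \<le> (\<integral>\<^sup>+y. ennreal (g y) \<partial>measure_pmf R)"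
proof (cases "(\<integral>\<^sup>+y. ennreal (g y) \<partial>measure_pmf R) = \<infinity>")
  case False
  define p r where "p = pmf P" and "r = pmf R"
  have mass: "(\<lambda>y. p y - r y) sums 0"
    using sums_diff[OF sums_pmf sums_pmf, of P R] by (simp add: p_def r_def)
  have mean0: "(\<lambda>y. (p y - r y) * real y) sums 0"
    using sums_diff[OF sums_pmf_mean[OF intP] sums_pmf_mean[OF intR]] mean
    by (simp add: p_def r_def left_diff_distrib)
  have lin: "(\<lambda>y. (p y - r y) * (u + v * real y)) sums 0" for u v
    using sums_add[OF sums_mult[OF mass, of u] sums_mult[OF mean0, of v]]
    by (simp add: algebra_simps)
  define I where "I = {y. r y \<le> p y}"
  have I_iff: "y \<in> I \<longleftrightarrow> 1 \<le> p y / r y" for y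
    using Rpos[of y] by (simp add: I_def p_def r_def)
  have I_interval: "j \<in> I" if "i \<in> I" "k \<in> I" "i \<le> j" "j \<le> k" for i j k
    using log_concave_seq_ge_one_interval[OF ratio _ that(3,4)] that(1,2)
    by (simp add: I_iff p_def r_def)
  have "I \<noteq> {}"
  proof
    assume "I = {}"
    then have less: "p y < r y" for y by (auto simp: I_def not_le)
    have "(\<lambda>y. r y - p y) sums 0" using sums_minus[OF mass] by simp
    then have "r 0 - p 0 = 0"
      by (rule sums_zero_nonneg_imp_zero) (use less in \<open>simp add: less_imp_le\<close>)
    with less[of 0] show False by simp
  qed
  define a where "a = (LEAST y. y \<in> I)"
  have aI: "a \<in> I" using \<open>I \<noteq> {}\<close> unfolding a_def by (metis LeastI all_not_in_conv)
  have a_le: "a \<le> y" if "y \<in> I" for y unfolding a_def using that by (rule Least_le)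
  show ?thesis
  proof (cases "finite I")
    case True
    \<comment> \<open>If \<open>I\<close> is a single point, the chord is taken one step further. This does no harm: at its
      right end it meets \<open>g\<close>, so the sign of \<open>P - R\<close> there is irrelevant.\<close>
    define c where "c = max (Max I) (Suc a)"
    have "a < c" by (simp add: c_def)
    from g this obtain u v where
      inner: "\<And>y. a \<le> y \<Longrightarrow> y \<le> c \<Longrightarrow> g y \<le> u + v * real y" and
      outer: "\<And>y. y \<le> a \<or> c \<le> y \<Longrightarrow> u + v * real y \<le> g y"
      by (rule convex_seq_chord) blast
    have chord: "(p y - r y) * (g y - (u + v * real y)) \<le> 0" for y
    proof (cases "y \<in> I")
      case yI: True
      then have "y \<le> c" using Max_ge[OF True] by (simp add: c_def le_max_iff_disj)
      then show ?thesis using inner[of y] a_le[OF yI] yI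
        by (intro mult_nonneg_nonpos) (auto simp: I_def)
    next
      case yI: False
      have "y \<le> a \<or> c \<le> y"
      proof (rule ccontr)
        assume "\<not> (y \<le> a \<or> c \<le> y)"
        then have "a \<le> y" "y \<le> Max I" by (auto simp: c_def)
        then show False using I_interval[OF aI Max_in[OF True \<open>I \<noteq> {}\<close>]] yI by blast
      qed
      then show ?thesis using outer[of y] yI
        by (intro mult_nonpos_nonneg) (auto simp: I_def)
    qed
    \<comment> \<open>\<open>h\<close> has the same sum as \<open>r * g\<close>, and bounding by it avoids assuming that \<open>p * g\<close> is
      summable.\<close>
    define h where "h y = r y * g y + (p y - r y) * (u + v * real y)" for y
    have ph: "p y * g y \<le> h y" for y
      using chord[of y] by (simp add: h_def algebra_simps)
    have sum_r: "(\<integral>\<^sup>+y. ennreal (g y) \<partial>measure_pmf R) = (\<Sum>y. ennreal (r y * g y))"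
      by (simp add: nn_integral_measure_pmf nn_integral_count_space_nat r_def ennreal_mult g0)
    have r_summable: "summable (\<lambda>y. r y * g y)"
      using False unfolding sum_r
      by (intro summable_suminf_not_top) (auto simp: r_def g0)
    have "h sums ((\<Sum>y. r y * g y) + 0)"
      unfolding h_def by (intro sums_add summable_sums[OF r_summable] lin)
    then have h: "h sums (\<Sum>y. r y * g y)" by simp
    have "(\<integral>\<^sup>+y. ennreal (g y) \<partial>measure_pmf P) = (\<Sum>y. ennreal (p y * g y))"
      by (simp add: nn_integral_measure_pmf nn_integral_count_space_nat p_def ennreal_mult g0)
    also have "\<dots> \<le> (\<Sum>y. ennreal (h y))"
      by (intro suminf_le ennreal_leI ph) auto
    also have "\<dots> = ennreal (\<Sum>y. r y * g y)"
    proof -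
      have "0 \<le> h y" for y
        by (rule order_trans[OF _ ph]) (simp add: p_def g0)
      then show ?thesis by (rule suminf_ennreal_eq[OF _ h])
    qed
    also have "\<dots> = (\<integral>\<^sup>+y. ennreal (g y) \<partial>measure_pmf R)"
      unfolding sum_r by (intro suminf_ennreal2[symmetric] r_summable) (auto simp: r_def g0)
    finally show ?thesis .
  next
    case inf: False
    have above: "y \<in> I" if "a \<le> y" for y
    proof -
      obtain k where "k \<in> I" "y \<le> k"
        using inf unfolding infinite_nat_iff_unbounded_le by blast
      then show ?thesis using I_interval[OF aI _ that] by blast
    qed
    \<comment> \<open>The affine weight changes sign where \<open>p - r\<close> does. The half-integral offset keeps it from
      vanishing at any natural number, so that a zero product forces \<open>p = r\<close>.\<close>
    let ?t = "\<lambda>y. (p y - r y) * ((1/2 - real a) + 1 * real y)"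
    have "0 \<le> ?t y" for y
    proof (cases "a \<le> y")
      case True
      then show ?thesis using above[OF True] by (intro mult_nonneg_nonneg) (auto simp: I_def)
    next
      case False
      then have "y \<notin> I" "real y + 1 \<le> real a" using a_le by force+
      then show ?thesis by (intro mult_nonpos_nonpos) (auto simp: I_def)
    qed
    then have t0: "?t y = 0" for y
      by (rule sums_zero_nonneg_imp_zero[OF lin])
    have "p y = r y" for y
    proof -
      have "(1/2 - real a) + 1 * real y \<noteq> 0"
      proof
        assume "(1/2 - real a) + 1 * real y = 0"
        then have "real (2 * a) = real (2 * y + 1)" by simp
        then have "2 * a = 2 * y + 1" by (simp only: of_nat_eq_iff)
        then show False by presburger
      qed
      then show ?thesis using t0[of y] by simp
    qed
    then have "P = R" by (intro pmf_eqI) (simp add: p_def r_def)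
    then show ?thesis by simp
  qed
qed simp

section \<open>Entropy and cross-entropy\<close>

text \<open>
  This is \<open>ln t \<le> t - 1\<close> at \<open>t = F x / R x\<close>, summed over \<open>x\<close>. The masses of \<open>R\<close> and \<open>F\<close> are
  kept on opposite sides and cancelled only at the end: all summands are then nonnegative, and the
  inequality also holds when one of the sums is infinite.
\<close>

lemma gibbs_inequality:
  fixes R F :: "nat pmf"
  assumes Fpos: "\<And>x. pmf F x > 0"
  shows "discrete_entropy R \<le> (\<integral>\<^sup>+x. ennreal (- ln (pmf F x)) \<partial>measure_pmf R)"
proof -
  have neg_ln: "0 \<le> - ln (pmf F x)" for x
    using Fpos[of x] by (simp add: pmf_le_1)
  have ent0: "0 \<le> - (pmf R x * ln (pmf R x))" for x
    by (cases "pmf R x = 0") (auto simp: mult_nonneg_nonpos pmf_le_1 pmf_pos)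
  have mass: "(\<Sum>x. ennreal (pmf S x)) = 1" for S :: "nat pmf"
    using suminf_ennreal_eq[OF pmf_nonneg sums_pmf] by (simp only: ennreal_1)
  have pointwise: "- (pmf R x * ln (pmf R x)) + pmf R x \<le> pmf R x * (- ln (pmf F x)) + pmf F x" for x
  proof (cases "pmf R x = 0")
    case False
    then have R: "pmf R x > 0" by (simp add: pmf_pos)
    have "ln (pmf F x / pmf R x) \<le> pmf F x / pmf R x - 1"
      using R Fpos[of x] by (intro ln_le_minus_one) simp
    then have "pmf R x * ln (pmf F x / pmf R x) \<le> pmf R x * (pmf F x / pmf R x - 1)"
      using R by (intro mult_left_mono) auto
    then show ?thesis using R Fpos[of x] by (simp add: ln_div algebra_simps)
  qed simp
  have "discrete_entropy R + 1
      = (\<Sum>x. ennreal (- (pmf R x * ln (pmf R x)))) + (\<Sum>x. ennreal (pmf R x))"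
    by (simp only: discrete_entropy_def mass)
  also have "\<dots> = (\<Sum>x. ennreal (- (pmf R x * ln (pmf R x)) + pmf R x))"
    by (simp only: suminf_add[OF summableI summableI] ennreal_plus[OF ent0 pmf_nonneg])
  also have "\<dots> \<le> (\<Sum>x. ennreal (pmf R x * (- ln (pmf F x)) + pmf F x))"
    by (intro suminf_le ennreal_leI pointwise) auto
  also have "\<dots> = (\<Sum>x. ennreal (pmf R x * (- ln (pmf F x)))) + (\<Sum>x. ennreal (pmf F x))"
    by (simp only: suminf_add[OF summableI summableI]
        ennreal_plus[OF mult_nonneg_nonneg[OF pmf_nonneg neg_ln] pmf_nonneg])
  also have "\<dots> = (\<integral>\<^sup>+x. ennreal (- ln (pmf F x)) \<partial>measure_pmf R) + 1"
    by (simp only: mass nn_integral_measure_pmf nn_integral_count_space_nat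
        ennreal_mult[OF pmf_nonneg neg_ln])
  finally show ?thesis by simp
qed

lemma discrete_entropy_eq_cross_entropy:
  fixes F :: "nat pmf"
  shows "discrete_entropy F = (\<integral>\<^sup>+x. ennreal (- ln (pmf F x)) \<partial>measure_pmf F)"
  unfolding discrete_entropy_def nn_integral_measure_pmf nn_integral_count_space_nat
proof (rule suminf_cong)
  fix x
  show "ennreal (- (pmf F x * ln (pmf F x))) = ennreal (pmf F x) * ennreal (- ln (pmf F x))"
    by (subst ennreal_mult'[symmetric]) auto
qed

section \<open>Compounding\<close>

definition compound_mean :: "nat pmf \<Rightarrow> (nat \<Rightarrow> real) \<Rightarrow> nat \<Rightarrow> ennreal" where
  "compound_mean Q g y = (\<integral>\<^sup>+xs. ennreal (g (sum_list xs)) \<partial>measure_pmf (replicate_pmf y Q))"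

lemma nn_integral_compound_pmf:
  "(\<integral>\<^sup>+x. ennreal (g x) \<partial>measure_pmf (compound_pmf Q P)) = (\<integral>\<^sup>+y. compound_mean Q g y \<partial>measure_pmf P)"
  by (simp add: compound_pmf_def compound_mean_def)

lemma compound_mean_Suc:
  "compound_mean Q g (Suc y) = (\<integral>\<^sup>+a. compound_mean Q (\<lambda>s. g (s + a)) y \<partial>measure_pmf Q)"
  by (simp add: compound_mean_def add.commute)

text \<open>
  Split off two summands \<open>a\<close>, \<open>b\<close> and let \<open>s\<close> be the sum of the other \<open>y\<close>. Both \<open>s + a\<close> and
  \<open>s + b\<close> have the law of a sum of \<open>Suc y\<close> variables, so the claim is the expectation of the
  pointwise inequality for shifted pairs.
\<close>

lemma compound_mean_convex:
  assumes g: "convex_seq g" and g0: "\<And>x. 0 \<le> g x"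
  shows "2 * compound_mean Q g (Suc y) \<le> compound_mean Q g y + compound_mean Q g (Suc (Suc y))"
proof -
  let ?Q = "measure_pmf Q" and ?S = "measure_pmf (replicate_pmf y Q)"
  let ?E = "\<lambda>f. \<integral>\<^sup>+a. \<integral>\<^sup>+b. \<integral>\<^sup>+xs. ennreal (f a b (sum_list xs)) \<partial>?S \<partial>?Q \<partial>?Q"
  have E_add: "?E (\<lambda>a b s. f a b s + f' a b s) = ?E f + ?E f'"
    if "\<And>a b s. 0 \<le> f a b s" "\<And>a b s. 0 \<le> f' a b s" for f f'
    using that by (simp add: nn_integral_add)
  have "2 * compound_mean Q g (Suc y) = ?E (\<lambda>a b s. g (s + a)) + ?E (\<lambda>a b s. g (s + b))"
    by (simp add: compound_mean_Suc mult_2) (simp add: compound_mean_def)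
  also have "\<dots> = ?E (\<lambda>a b s. g (s + a) + g (s + b))"
    using g0 by (intro E_add[symmetric]) auto
  also have "\<dots> \<le> ?E (\<lambda>a b s. g s + g (s + b + a))"
    by (intro nn_integral_mono ennreal_leI) (metis convex_seq_shift_pair[OF g] add.assoc add.commute)
  also have "\<dots> = ?E (\<lambda>a b s. g s) + ?E (\<lambda>a b s. g (s + b + a))"
    using g0 by (intro E_add) auto
  also have "\<dots> = compound_mean Q g y + compound_mean Q g (Suc (Suc y))"
    by (simp add: compound_mean_Suc) (simp add: compound_mean_def)
  finally show ?thesis .
qed

text \<open>
  The convex order between \<open>P\<close> and \<open>R\<close> passes to their compounds. An infinite value of the
  conditional expectation makes the right-hand side infinite because \<open>R\<close> charges every point;
  otherwise the conditional expectation is a real convex sequence.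
\<close>

lemma nn_integral_compound_pmf_mono:
  fixes P R Q :: "nat pmf" and g :: "nat \<Rightarrow> real"
  assumes ratio: "log_concave_seq (\<lambda>y. pmf P y / pmf R y)"
    and Rpos: "\<And>y. pmf R y > 0"
    and intP: "integrable (measure_pmf P) real" and intR: "integrable (measure_pmf R) real"
    and mean: "measure_pmf.expectation P real = measure_pmf.expectation R real"
    and g: "convex_seq g" and g0: "\<And>y. 0 \<le> g y"
  shows "(\<integral>\<^sup>+x. ennreal (g x) \<partial>measure_pmf (compound_pmf Q P))
       \<le> (\<integral>\<^sup>+x. ennreal (g x) \<partial>measure_pmf (compound_pmf Q R))"
proof (cases "\<exists>y. compound_mean Q g y = \<infinity>")
  case True
  then obtain y where y: "compound_mean Q g y = \<infinity>" by blast
  have "ennreal (pmf R y) * compound_mean Q g y \<le> (\<integral>\<^sup>+y. compound_mean Q g y \<partial>measure_pmf R)"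
    unfolding nn_integral_measure_pmf
    using nn_integral_ge_point[of y UNIV "\<lambda>y. ennreal (pmf R y) * compound_mean Q g y"] by simp
  moreover have "ennreal (pmf R y) * compound_mean Q g y = \<infinity>"
    using y Rpos[of y] by (simp add: ennreal_mult_top)
  ultimately show ?thesis by (simp add: nn_integral_compound_pmf top_unique)
next
  case False
  define G where "G y = enn2real (compound_mean Q g y)" for y
  have G: "compound_mean Q g y = ennreal (G y)" for y
    using False by (simp add: G_def less_top)
  have G0: "0 \<le> G y" for y by (simp add: G_def)
  have "convex_seq G"
    unfolding convex_seq_def
  proof
    fix n
    have "ennreal (2 * G (Suc n)) \<le> ennreal (G n + G (Suc (Suc n)))"
      using compound_mean_convex[OF g g0, where Q = Q and y = n] G0
      by (simp add: G ennreal_mult)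
    then show "2 * G (Suc n) \<le> G n + G (Suc (Suc n))"
      using G0 by (subst (asm) ennreal_le_iff) auto
  qed
  then show ?thesis
    using log_concave_ratio_imp_convex_order[OF ratio Rpos intP intR mean _ G0]
    by (simp add: nn_integral_compound_pmf G)
qed

text \<open>
  If \<open>q > 0\<close> is an atom of \<open>Q\<close>, then every multiple of \<open>q\<close> is an atom of the compound law,
  including \<open>0\<close>. Its support is an interval by log-concavity, and so it is everything.
\<close>

lemma compound_poisson_pmf_pos:
  assumes "l > 0" and Q0: "pmf Q 0 = 0" and lc: "log_concave_pmf (compound_poisson_pmf l Q)"
  shows "pmf (compound_poisson_pmf l Q) x > 0"
proof -
  let ?F = "compound_poisson_pmf l Q"
  obtain q where q: "q \<in> set_pmf Q" using set_pmf_not_empty by fastforce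
  have "q \<noteq> 0" using q Q0 by (metis set_pmf_iff)
  have supp: "y * q \<in> set_pmf ?F" for y
  proof -
    have "replicate y q \<in> set_pmf (replicate_pmf y Q)"
      using q by (auto simp: set_replicate_pmf in_lists_conv_set)
    then have "sum_list (replicate y q) \<in> set_pmf (map_pmf sum_list (replicate_pmf y Q))"
      by (subst set_map_pmf) (rule imageI)
    moreover have "y \<in> set_pmf (poisson_pmf l)"
      using \<open>l > 0\<close> by simp
    ultimately show ?thesis
      unfolding compound_poisson_pmf_def compound_pmf_def set_bind_pmf
      by (auto simp: sum_list_replicate)
  qed
  have "pmf ?F 0 \<noteq> 0" using supp[of 0] by (simp add: set_pmf_iff)
  moreover have "pmf ?F (x * q) \<noteq> 0" using supp[of x] by (simp add: set_pmf_iff)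
  moreover have "x \<le> x * q" using \<open>q \<noteq> 0\<close> by simp
  ultimately have "pmf ?F x \<noteq> 0"
    using lc unfolding log_concave_pmf_def log_concave_seq_def by blast
  then show ?thesis by (simp add: pmf_pos)
qed

lemma poisson_pmf_mean:
  assumes "l > 0"
  shows "integrable (measure_pmf (poisson_pmf l)) real"
    and "measure_pmf.expectation (poisson_pmf l) real = l"
proof -
  have "(\<lambda>y. pmf (poisson_pmf l) (Suc y) * real (Suc y)) = (\<lambda>y. l * pmf (poisson_pmf l) y)"
    using \<open>l > 0\<close> by (auto simp: field_simps simp del: of_nat_Suc)
  then have "(\<lambda>y. pmf (poisson_pmf l) (Suc y) * real (Suc y)) sums l"
    using sums_mult[OF sums_pmf[of "poisson_pmf l"], of l] by simp
  then have sums: "(\<lambda>y. pmf (poisson_pmf l) y * real y) sums l"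
    by (subst (asm) sums_Suc_iff) simp
  then have "integrable (count_space UNIV) (\<lambda>y. pmf (poisson_pmf l) y * real y)"
    by (subst integrable_count_space_nat_iff) (auto simp: sums_iff)
  then show int: "integrable (measure_pmf (poisson_pmf l)) real"
    unfolding measure_pmf_eq_density by (subst integrable_density) auto
  show "measure_pmf.expectation (poisson_pmf l) real = l"
    using sums_pmf_mean[OF int] sums by (rule sums_unique2)
qed

lemma ultra_log_concave_pmf_iff:
  assumes "l > 0"
  shows "ultra_log_concave_pmf P \<longleftrightarrow> log_concave_seq (\<lambda>x. pmf P x / pmf (poisson_pmf l) x)"
  unfolding ultra_log_concave_pmf_def using assms log_concave_seq_div_poisson_iff by blast

theorem theorem2p4:
  fixes l :: real and Q :: "nat pmf"
  assumes "l > 0"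
    and "pmf Q 0 = 0"
    and "log_concave_pmf Q"
    and "log_concave_pmf (compound_poisson_pmf l Q)"
  shows "is_maximum (discrete_entropy (compound_poisson_pmf l Q))
           {discrete_entropy (compound_pmf Q P) | P.
              ultra_log_concave_pmf P \<and> measure_pmf.expectation P real = l}"
proof -
  let ?R = "poisson_pmf l" and ?F = "compound_poisson_pmf l Q"
  have Rpos: "pmf ?R y > 0" for y using \<open>l > 0\<close> by simp
  have "ultra_log_concave_pmf ?R"
    unfolding ultra_log_concave_pmf_iff[OF \<open>l > 0\<close>] using Rpos
    by (simp add: log_concave_seq_def less_imp_neq[symmetric])
  then have attained: "discrete_entropy ?F \<in> {discrete_entropy (compound_pmf Q P) | P.
      ultra_log_concave_pmf P \<and> measure_pmf.expectation P real = l}"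
    using poisson_pmf_mean(2)[OF \<open>l > 0\<close>] unfolding compound_poisson_pmf_def by blast
  have Fpos: "pmf ?F x > 0" for x
    using assms by (intro compound_poisson_pmf_pos)
  define g where "g x = - ln (pmf ?F x)" for x
  have g0: "0 \<le> g x" for x using Fpos[of x] by (simp add: g_def pmf_le_1)
  have g: "convex_seq g"
    unfolding convex_seq_def g_def using assms(4) Fpos
    by (intro allI log_concave_seq_imp_neg_ln_convex) (auto simp: log_concave_pmf_def)
  have "discrete_entropy (compound_pmf Q P) \<le> discrete_entropy ?F"
    if ulc: "ultra_log_concave_pmf P" and mean: "measure_pmf.expectation P real = l" for P
  proof -
    \<comment> \<open>The expectation of a non-integrable function is \<open>0\<close> by convention, but \<open>l > 0\<close>.\<close>
    have intP: "integrable (measure_pmf P) real"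
      using mean \<open>l > 0\<close> not_integrable_integral_eq by force
    have "discrete_entropy (compound_pmf Q P)
        \<le> (\<integral>\<^sup>+x. ennreal (g x) \<partial>measure_pmf (compound_pmf Q P))"
      unfolding g_def by (rule gibbs_inequality[OF Fpos])
    also have "\<dots> \<le> (\<integral>\<^sup>+x. ennreal (g x) \<partial>measure_pmf (compound_pmf Q ?R))"
      using ulc mean poisson_pmf_mean[OF \<open>l > 0\<close>]
      by (intro nn_integral_compound_pmf_mono Rpos intP g g0)
         (simp_all only: ultra_log_concave_pmf_iff[OF \<open>l > 0\<close>])
    also have "\<dots> = discrete_entropy ?F"
      unfolding discrete_entropy_eq_cross_entropy g_def compound_poisson_pmf_def ..
    finally show ?thesis .
  qed
  with attained show ?thesis
    unfolding is_maximum_def by blast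
qed

end
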